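(* Let $v$ be an internal vertex of a tree $T$ and let $C_1,\dots,C_m$ be the components of $T-v$. Then $\mathrm{str}(v)=\sum_{i<j}|C_i||C_j|$.
   Context: Graphs are finite, undirected and simple. A geodesic is a shortest path between two vertices (a path and its reverse are the same geodesic); it passes through a vertex $v$ if $v$ is an internal vertex of it. The stress $\mathrm{str}(v)$ of a vertex $v$ is the number of geodesics in the graph passing through $v$. An internal vertex of a tree is a vertex that is not a leaf. $T-v$ is the graph obtained by deleting $v$, and $|C_i|$ is the number of vertices of $C_i$. *)

theory Defs
  imports "Graph_Theory.Graph_Theory"
begin

text \<open>
  A finite simple undirected graph is a digraph satisfying the locale predicate \<open>graph\<close>: an
  edge is a pair of opposite arcs. The library predicate \<open>tree\<close> is a notion for directed graphs:
  it rejects such a graph as soon as it has an edge, since \<open>u, w, u\<close> then counts as a cycle.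
  The cycles of the undirected graph are the directed ones with at least three arcs.
\<close>

definition undirected_tree :: "('a, 'b) pre_digraph \<Rightarrow> bool" where
  "undirected_tree G \<longleftrightarrow>
     graph G \<and> connected G \<and> \<not> (\<exists>p. pre_digraph.cycle G p \<and> length p \<ge> 3)"

text \<open>In a \<open>graph\<close> the degree of a vertex is its out-degree.\<close>

definition leaf :: "('a, 'b) pre_digraph \<Rightarrow> 'a \<Rightarrow> bool" where
  "leaf G v \<longleftrightarrow> v \<in> verts G \<and> out_degree G v = 1"

definition internal_vertex :: "('a, 'b) pre_digraph \<Rightarrow> 'a \<Rightarrow> bool" where
  "internal_vertex G v \<longleftrightarrow> v \<in> verts G \<and> \<not> leaf G v"

text \<open>
  A subgraph in the sense of the library may contain one of two opposite arcs only; a maximal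
  connected one is induced, hence symmetric if \<open>G\<close> is. The empty graph is not \<open>connected\<close>.
\<close>

definition graph_components :: "('a, 'b) pre_digraph \<Rightarrow> ('a, 'b) pre_digraph set" where
  "graph_components G = {H. pre_digraph.max_subgraph G connected H}"

definition shortest_vpath :: "('a, 'b) pre_digraph \<Rightarrow> 'a vwalk \<Rightarrow> bool" where
  "shortest_vpath G p \<longleftrightarrow> vpath p G \<and>
     (\<forall>q. vpath q G \<and> hd q = hd p \<and> last q = last p \<longrightarrow> vwalk_length p \<le> vwalk_length q)"

text \<open>
  A geodesic is the class of a shortest path up to reversal. The internal vertices of a path
  \<open>p\<close> are those of \<open>butlast (tl p)\<close>.
\<close>

definition geodesics_through :: "('a, 'b) pre_digraph \<Rightarrow> 'a \<Rightarrow> 'a vwalk set set" where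
  "geodesics_through G v =
     {{p, rev p} | p. shortest_vpath G p \<and> v \<in> set (butlast (tl p))}"

definition stress :: "('a, 'b) pre_digraph \<Rightarrow> 'a \<Rightarrow> nat" where
  "stress G v = card (geodesics_through G v)"

end

theory Submission
  imports Defs
begin

text \<open>
  In a tree any two vertices are joined by exactly one path (\<open>tree_ex1_vpath\<close>), so every path is
  shortest, and a geodesic amounts to the unordered pair of its ends. It remains to see which
  pairs \<open>x, y\<close> give a geodesic through \<open>v\<close>. If both ends differ from \<open>v\<close> and lie in the same
  component of \<open>T - v\<close>, then some path of \<open>T - v\<close> joins them; it is also a path of \<open>T\<close>, hence the
  only one, and it avoids \<open>v\<close>. If they lie in different components, their path cannot stay in
  \<open>T - v\<close> and passes through \<open>v\<close> (\<open>tree_vpath_avoids_iff\<close>). So the stress of \<open>v\<close> is the number of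
  unordered pairs of vertices from different components. Numbering the components picks one
  orientation of each pair, with the component of \<open>x\<close> before that of \<open>y\<close>, and these ordered pairs
  form the disjoint union of the products \<open>V\<^sub>i \<times> V\<^sub>j\<close> with \<open>i < j\<close>, where \<open>V\<^sub>i\<close> is the vertex set
  of the \<open>i\<close>-th component.

  For components defined as maximal connected subgraphs, the fact used is that in a symmetric
  digraph they are the strongly connected components (\<open>graph_components_eq_sccs\<close>), whose vertex
  sets are the classes of the equivalence relation of reachability.
\<close>

section \<open>Uniqueness of paths in a tree\<close>

text \<open>
  Paths are lists of vertices and cycles are lists of arcs; this passes from the former to the
  latter.
\<close>

lemma (in wf_digraph) vwalk_imp_ex_awalk:
  assumes "vwalk p G"
  shows "\<exists>es. awalk (hd p) es (last p) \<and> awalk_verts (hd p) es = p"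
  using assms
proof (induct p rule: vwalk_induct)
  case (Base u)
  then show ?case by (auto intro!: exI[of _ "[]"] simp: awalk_Nil_iff)
next
  case (Cons u w ws)
  then obtain es where es: "awalk w es (last (w # ws))" "awalk_verts w es = w # ws"
    by auto
  from Cons obtain e where "e \<in> arcs G" "tail G e = u" "head G e = w" by auto
  with es show ?case by (intro exI[of _ "e # es"]) (auto simp: awalk_Cons_iff)
qed

text \<open>
  Follow the first path up to the first vertex \<open>w\<close> that lies on the second one, and return to
  \<open>u\<close> along the second. By the choice of \<open>w\<close> the two pieces share only their ends. They cannot both
  be the single arc from \<open>u\<close> to \<open>w\<close>, since the paths leave \<open>u\<close> towards different vertices; so the
  cycle has at least three arcs.
\<close>

lemma (in sym_digraph) diverging_vpaths_imp_cycle: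
  assumes p: "vpath (u # a # p) G" and q: "vpath (u # b # q) G"
    and neq: "a \<noteq> b" and last: "last (a # p) = last (b # q)"
  shows "\<exists>c. cycle c \<and> length c \<ge> 3"
proof -
  have "last (a # p) \<in> set (a # p)" "last (a # p) \<in> set (b # q)"
    using last_in_set[of "a # p"] last_in_set[of "b # q"] last by simp_all
  then obtain xs w ys where xs: "a # p = xs @ w # ys" "w \<in> set (b # q)"
    "\<forall>x \<in> set xs. x \<notin> set (b # q)"
    using split_list_first_prop[of "a # p" "\<lambda>x. x \<in> set (b # q)"] by blast
  obtain zs ws where zs: "b # q = zs @ w # ws"
    using split_list[OF xs(2)] by blast
  have p': "vwalk (u # xs @ w # ys) G" "distinct (u # xs @ w # ys)"
    and q': "vwalk (u # zs @ w # ws) G" "distinct (u # zs @ w # ws)"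
    using p q unfolding xs(1) zs vpath_def by simp_all
  have walk_p: "vwalk (u # xs @ [w]) G" and walk_q: "vwalk (u # zs @ [w]) G"
    using p'(1) q'(1) vwalkI_append_l[of "u # xs @ [w]" ys G]
      vwalkI_append_l[of "u # zs @ [w]" ws G] by auto
  have "vwalk ((u # xs @ [w]) \<oplus> rev (u # zs @ [w])) G"
    using walk_p vwalk_rev_ex[OF sym_arcs walk_q] by (rule vwalk_joinI_vwalk') simp
  then have "vwalk (u # xs @ w # rev zs @ [u]) G" by (simp add: vwalk_join_def)
  from vwalk_imp_ex_awalk[OF this] obtain c
    where c: "awalk u c u" "awalk_verts u c = u # xs @ w # rev zs @ [u]" by auto
  have "distinct (tl (awalk_verts u c))"
    using p'(2) q'(2) xs(3) unfolding c(2) zs by auto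
  moreover have "length c \<ge> 3"
  proof -
    have "xs \<noteq> [] \<or> zs \<noteq> []" using neq xs(1) zs by auto
    then show ?thesis using length_awalk_verts[of u c] unfolding c(2)
      by (cases xs; cases zs) auto
  qed
  ultimately show ?thesis using c(1) unfolding cycle_def by (intro exI[of _ c]) auto
qed

text \<open>
  Once their common initial segment is stripped off, two different paths with the same ends
  diverge, and then they close a cycle.
\<close>

lemma (in sym_digraph) vpath_unique:
  assumes acyclic: "\<not> (\<exists>c. cycle c \<and> length c \<ge> 3)"
    and "vpath p G" "vpath q G" "hd p = hd q" "last p = last q"
  shows "p = q"
  using assms(2-)
proof (induct p arbitrary: q)
  case Nil
  then show ?case by auto
next
  case (Cons u p)
  from Cons.prems obtain q' where q: "q = u # q'" by (cases q) auto
  show ?case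
  proof (cases "p = [] \<or> q' = []")
    case True
    with Cons.prems show ?thesis unfolding q by (auto simp: vpath_def split: if_splits)
  next
    case False
    then obtain a p'' b q'' where ab: "p = a # p''" "q' = b # q''"
      by (meson neq_Nil_conv)
    with Cons.prems q have last: "last (a # p'') = last (b # q'')" by simp
    with Cons.prems have "a = b"
      using diverging_vpaths_imp_cycle acyclic unfolding q ab by blast
    moreover have "vpath p G" "vpath q' G"
      using Cons.prems unfolding q ab vpath_def by auto
    ultimately show ?thesis using Cons.hyps[of q'] last unfolding q ab by auto
  qed
qed

text \<open>
  A path in a tree has no competitor but itself.
\<close>

lemma (in pre_digraph) shortest_vpath_iff_vpath:
  assumes "undirected_tree G"
  shows "shortest_vpath G p \<longleftrightarrow> vpath p G"
proof -
  interpret graph G using assms by (simp add: undirected_tree_def)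
  show ?thesis
    using vpath_unique assms unfolding undirected_tree_def shortest_vpath_def
    by (metis order_refl)
qed

lemma (in pre_digraph) tree_ex1_vpath:
  assumes "undirected_tree G" "x \<in> verts G" "y \<in> verts G"
  shows "\<exists>!p. vpath p G \<and> hd p = x \<and> last p = y"
proof -
  interpret graph G using assms by (simp add: undirected_tree_def)
  have "strongly_connected G"
    using assms sym_arcs symmetric_connected_imp_strongly_connected
    by (simp add: undirected_tree_def)
  then have "x \<rightarrow>\<^sup>* y" using assms by (auto simp: strongly_connected_def)
  then obtain p where "vpath p G" "hd p = x" "last p = y"
    by (auto simp: reachable_vpath_conv)
  then show ?thesis
    using vpath_unique assms(1) unfolding undirected_tree_def by metis
qed

section \<open>Components of a symmetric digraph\<close>

lemma strongly_connected_imp_connected: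
  assumes "strongly_connected G"
  shows "connected G"
  using assms unfolding connected_conv strongly_connected_def reachable_def
  by (metis rtrancl_on_mono order_refl symcl_def Un_upper1)

text \<open>
  Because of this, a maximal connected subgraph contains every arc between its vertices.
\<close>

lemma arc_mono_connected: "arc_mono connected"
  unfolding arc_mono_def
  by (metis spanning_def subgraphE subgraph_def wf_digraph.connected_spanning_imp_connected)

text \<open>
  A subgraph may be connected without being strongly connected, as it may lack the reverse of
  some arc. An induced subgraph of a symmetric digraph is symmetric, and for it the two notions
  agree; maximal subgraphs of either kind are induced.
\<close>

lemma (in sym_digraph) graph_components_eq_sccs: "graph_components G = sccs"
proof -
  have induced_sc: "strongly_connected H" if "induced_subgraph H G" "connected H" for H
  proof -
    interpret H: wf_digraph H using that(1) by auto
    show ?thesis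
      using H.symmetric_connected_imp_strongly_connected that
        induced_graph_imp_symmetric[OF sym_arcs] by blast
  qed
  have "max_subgraph strongly_connected H" if "max_subgraph connected H" for H
    using that induced_subgraphI_arc_mono[OF that arc_mono_connected] induced_sc
      max_subgraph_mp[OF that] strongly_connected_imp_connected max_subgraph_prop by blast
  moreover have "max_subgraph connected H" if H: "max_subgraph strongly_connected H" for H
  proof (rule max_subgraphI)
    show "subgraph H G" "connected H"
      using H strongly_connected_imp_connected by (auto simp: max_subgraph_def)
    fix K assume K: "H \<noteq> K" "subgraph H K" "subgraph K G"
    show "\<not> connected K"
    proof
      assume "connected K"
      \<comment> \<open>\<open>K\<close> may not be strongly connected, but the subgraph induced on its vertices is.\<close>
      let ?K = "G \<restriction> verts K"
      have ind: "induced_subgraph ?K G" and sub: "subgraph K ?K"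
        using K(3) by (auto intro: subgraph_induce_subgraphI2 induced_induce)
      interpret K': wf_digraph ?K using ind by auto
      have "strongly_connected ?K"
        using ind \<open>connected K\<close> K'.connected_spanning_imp_connected[of K] sub
        by (intro induced_sc) (auto simp: spanning_def)
      then have "?K = H"
        using H ind subgraph_trans[OF K(2) sub] by (auto simp: max_subgraph_def)
      then show False using sub K(1,2) by (auto simp: subgraph_def compatible_def)
    qed
  qed
  ultimately show ?thesis unfolding graph_components_def sccs_altdef2 by blast
qed

lemma (in sym_digraph) verts_graph_component:
  assumes "H \<in> graph_components G" "x \<in> verts H"
  shows "verts H = {y. x \<rightarrow>\<^sup>* y}"
proof -
  have "verts H \<in> sccs_verts"
    using assms(1) unfolding graph_components_eq_sccs sccs_verts_conv by blast
  then have "verts H = scc_of x"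
    using assms(2) sccs_verts_disjoint sccs_verts_subsets scc_of_in_sccs_verts in_scc_of_self
    by blast
  then show ?thesis using symmetric_reachable' by (auto simp: scc_of_def)
qed

lemma (in sym_digraph) ex1_graph_component:
  assumes "x \<in> verts G"
  shows "\<exists>!H. H \<in> graph_components G \<and> x \<in> verts H"
  unfolding graph_components_eq_sccs using scc_for_vert_ex[OF assms] scc_disj by blast

section \<open>Geodesics through a vertex\<close>

lemma (in sym_digraph) sym_digraph_del_vert: "sym_digraph (del_vert v)"
proof -
  interpret D: wf_digraph "del_vert v" by (rule wf_digraph_del_vert)
  show ?thesis
    using sym_arcs by unfold_locales (fastforce simp: symmetric_conv del_vert_simps)
qed

lemma (in wf_digraph) vwalk_del_vert:
  assumes "vwalk p G" "v \<notin> set p"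
  shows "vwalk p (del_vert v)"
proof
  show "set p \<subseteq> verts (del_vert v)" "p \<noteq> []" using assms by (auto simp: verts_del_vert)
  show "set (vwalk_arcs p) \<subseteq> arcs_ends (del_vert v)"
  proof safe
    fix a b assume ab: "(a, b) \<in> set (vwalk_arcs p)"
    then have "(a, b) \<in> arcs_ends G" "a \<noteq> v" "b \<noteq> v"
      using assms by (auto elim: in_set_vwalk_arcsE)
    then show "(a, b) \<in> arcs_ends (del_vert v)"
      by (auto simp: arcs_ends_conv del_vert_simps)
  qed
qed

lemma mem_set_butlast_tl_iff:
  assumes "distinct p" "p \<noteq> []"
  shows "v \<in> set (butlast (tl p)) \<longleftrightarrow> v \<in> set p \<and> v \<noteq> hd p \<and> v \<noteq> last p"
proof (cases p)
  case (Cons a q)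
  then show ?thesis using assms by (cases q rule: rev_cases) auto
qed (use assms in simp)

text \<open>
  A path in \<open>G - v\<close> between the ends of \<open>p\<close> is a path in \<open>G\<close> as well, so by uniqueness it is \<open>p\<close>.
\<close>

lemma (in pre_digraph) tree_vpath_avoids_iff:
  assumes "undirected_tree G" "vpath p G" "hd p \<noteq> v" "last p \<noteq> v"
  shows "v \<notin> set p \<longleftrightarrow> hd p \<rightarrow>\<^sup>*\<^bsub>del_vert v\<^esub> last p"
proof -
  interpret graph G using assms by (simp add: undirected_tree_def)
  interpret D: wf_digraph "del_vert v" by (rule wf_digraph_del_vert)
  show ?thesis
  proof
    assume "v \<notin> set p"
    with assms(2) have "vwalk p (del_vert v)" by (auto intro: vwalk_del_vert)
    then show "hd p \<rightarrow>\<^sup>*\<^bsub>del_vert v\<^esub> last p" by (auto simp: D.reachable_vwalk_conv)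
  next
    assume "hd p \<rightarrow>\<^sup>*\<^bsub>del_vert v\<^esub> last p"
    then obtain q where q: "vpath q (del_vert v)" "hd q = hd p" "last q = last p"
      by (auto simp: D.reachable_vpath_conv)
    then have "vpath q G" by (auto intro: vpathI_subgraph subgraph_del_vert)
    then have "p = q" using vpath_unique assms q by (simp add: undirected_tree_def)
    then show "v \<notin> set p" using q(1) by (auto simp: verts_del_vert vpath_def vwalk_def)
  qed
qed

text \<open>
  Whether a geodesic passes through \<open>v\<close> can thus be read off from its two ends.
\<close>

lemma geodesics_through_tree:
  assumes "undirected_tree T"
  shows "geodesics_through T v = {{p, rev p} | p. vpath p T \<and>
    hd p \<noteq> v \<and> last p \<noteq> v \<and> \<not> hd p \<rightarrow>\<^sup>*\<^bsub>pre_digraph.del_vert T v\<^esub> last p}"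
proof -
  have "shortest_vpath T p \<and> v \<in> set (butlast (tl p)) \<longleftrightarrow> vpath p T \<and>
    hd p \<noteq> v \<and> last p \<noteq> v \<and> \<not> hd p \<rightarrow>\<^sup>*\<^bsub>pre_digraph.del_vert T v\<^esub> last p" for p
    using mem_set_butlast_tl_iff[of p v] pre_digraph.tree_vpath_avoids_iff[OF assms, of p v]
    unfolding pre_digraph.shortest_vpath_iff_vpath[OF assms] vpath_def vwalk_def by metis
  then show ?thesis unfolding geodesics_through_def by simp
qed

section \<open>Counting pairs of vertices in different components\<close>

definition (in pre_digraph) tree_path :: "'a \<Rightarrow> 'a \<Rightarrow> 'a vwalk" where
  "tree_path x y = (THE p. vpath p G \<and> hd p = x \<and> last p = y)"

lemma (in pre_digraph)
  assumes "undirected_tree G" "x \<in> verts G" "y \<in> verts G"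
  shows vpath_tree_path: "vpath (tree_path x y) G"
    and hd_tree_path: "hd (tree_path x y) = x"
    and last_tree_path: "last (tree_path x y) = y"
  using theI'[OF tree_ex1_vpath[OF assms]] by (auto simp: tree_path_def)

lemma (in pre_digraph) tree_path_eq:
  assumes "undirected_tree G" "vpath p G"
  shows "tree_path (hd p) (last p) = p"
proof -
  have "hd p \<in> verts G" "last p \<in> verts G" using assms by (auto simp: vpath_def vwalk_def)
  then show ?thesis
    unfolding tree_path_def using assms by (intro the1_equality tree_ex1_vpath) auto
qed

lemma (in pre_digraph) rev_tree_path:
  assumes "undirected_tree G" "x \<in> verts G" "y \<in> verts G"
  shows "rev (tree_path x y) = tree_path y x"
proof -
  interpret graph G using assms by (simp add: undirected_tree_def)
  let ?p = "rev (tree_path x y)"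
  have "vpath ?p G" and ne: "tree_path x y \<noteq> []"
    using vpath_tree_path[OF assms] vwalk_rev_ex[OF sym_arcs]
    by (auto simp: vpath_def vwalk_def)
  then have "tree_path (hd ?p) (last ?p) = ?p" using assms(1) by (intro tree_path_eq)
  then show ?thesis
    using ne hd_tree_path[OF assms] last_tree_path[OF assms] by (simp add: hd_rev last_rev)
qed

lemma (in pre_digraph) tree_path_class_eqD:
  assumes "undirected_tree G" "x \<in> verts G" "y \<in> verts G" "x' \<in> verts G" "y' \<in> verts G"
    and "{tree_path x y, rev (tree_path x y)} = {tree_path x' y', rev (tree_path x' y')}"
  shows "x = x' \<and> y = y' \<or> x = y' \<and> y = x'"
proof -
  have "tree_path x y = tree_path x' y' \<or> tree_path x y = tree_path y' x'"
    using assms(6) unfolding rev_tree_path[OF assms(1,4,5)] by (auto simp: doubleton_eq_iff)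
  then show ?thesis using assms(1-5) by (metis hd_tree_path last_tree_path)
qed

text \<open>
  The products are disjoint because pairs \<open>(i, j)\<close> and \<open>(k, l)\<close> that differ do so in some
  coordinate, where the two factors are disjoint.
\<close>

lemma card_UN_pairs_disjoint:
  fixes V :: "nat \<Rightarrow> 'a set"
  assumes fin: "\<And>i. i \<in> {1..m} \<Longrightarrow> finite (V i)" and disj: "disjoint_family_on V {1..m}"
  shows "card (\<Union>(i, j)\<in>{(i, j). 1 \<le> i \<and> i < j \<and> j \<le> m}. V i \<times> V j) =
    (\<Sum>(i, j)\<in>{(i, j). 1 \<le> i \<and> i < j \<and> j \<le> m}. card (V i) * card (V j))"
    (is "card (\<Union>(i, j)\<in>?I. _) = _")
proof -
  have I: "?I \<subseteq> {1..m} \<times> {1..m}" by auto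
  have "card (\<Union>k\<in>?I. V (fst k) \<times> V (snd k)) = (\<Sum>k\<in>?I. card (V (fst k) \<times> V (snd k)))"
  proof (rule card_UN_disjoint)
    show "finite ?I" by (rule finite_subset[OF I]) simp
    show "\<forall>k\<in>?I. finite (V (fst k) \<times> V (snd k))" using fin by auto
    show "\<forall>k\<in>?I. \<forall>l\<in>?I. k \<noteq> l \<longrightarrow>
      (V (fst k) \<times> V (snd k)) \<inter> (V (fst l) \<times> V (snd l)) = {}"
    proof (intro ballI impI)
      fix k l assume "k \<in> ?I" "l \<in> ?I" "k \<noteq> l"
      then have "{fst k, snd k, fst l, snd l} \<subseteq> {1..m}" "fst k \<noteq> fst l \<or> snd k \<noteq> snd l"
        by (auto simp: prod_eq_iff)
      then have "V (fst k) \<inter> V (fst l) = {} \<or> V (snd k) \<inter> V (snd l) = {}"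
        using disj unfolding disjoint_family_on_def by blast
      then show "(V (fst k) \<times> V (snd k)) \<inter> (V (fst l) \<times> V (snd l)) = {}" by blast
    qed
  qed
  then show ?thesis by (simp add: card_cartesian_product case_prod_unfold)
qed

theorem proposition3p2:
  fixes T :: "('a, 'b) pre_digraph" and v :: 'a
    and m :: nat and C :: "nat \<Rightarrow> ('a, 'b) pre_digraph"
  assumes "undirected_tree T"
    and "internal_vertex T v"
    and "bij_betw C {1..m} (graph_components (pre_digraph.del_vert T v))"
  shows "stress T v =
    (\<Sum>(i, j)\<in>{(i, j). 1 \<le> i \<and> i < j \<and> j \<le> m}. card (verts (C i)) * card (verts (C j)))"
proof -
  interpret graph T using assms(1) by (simp add: undirected_tree_def)
  interpret D: sym_digraph "del_vert v" by (rule sym_digraph_del_vert)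
  have comp: "C i \<in> graph_components (del_vert v)" if "i \<in> {1..m}" for i
    using assms(3) that by (auto simp: bij_betw_def)
  have reach: "verts (C i) = {y. x \<rightarrow>\<^sup>*\<^bsub>del_vert v\<^esub> y}"
    if "i \<in> {1..m}" "x \<in> verts (C i)" for i x
    using D.verts_graph_component comp that by blast
  have sub: "verts (C i) \<subseteq> verts T - {v}" if "i \<in> {1..m}" for i
    using comp[OF that] verts_del_vert[of v]
    unfolding graph_components_def pre_digraph.max_subgraph_def subgraph_def by auto
  have same: "i = j"
    if "i \<in> {1..m}" "j \<in> {1..m}" "x \<in> verts (C i)" "x \<in> verts (C j)" for i j x
  proof -
    have "x \<in> verts (del_vert v)" using sub[OF that(1)] that(3) verts_del_vert[of v] by auto
    from D.ex1_graph_component[OF this] have "C i = C j"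
      using comp[OF that(1)] comp[OF that(2)] that(3,4) by (elim ex1E) metis
    then show ?thesis
      using inj_onD[OF bij_betw_imp_inj_on[OF assms(3)] _ that(1,2)] by blast
  qed
  have cover: "\<exists>i\<in>{1..m}. x \<in> verts (C i)" if "x \<in> verts T - {v}" for x
  proof -
    have "x \<in> verts (del_vert v)" using that verts_del_vert[of v] by simp
    from D.ex1_graph_component[OF this]
    obtain H where H: "H \<in> graph_components (del_vert v)" "x \<in> verts H" by (elim ex1E) metis
    then have "H \<in> C ` {1..m}" using assms(3) by (simp add: bij_betw_def)
    then show ?thesis using H(2) by blast
  qed
  let ?I = "{(i, j). 1 \<le> i \<and> i < j \<and> j \<le> m}"
  \<comment> \<open>\<open>B\<close> holds exactly one orientation of each pair of vertices in different components.\<close>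
  define B where "B = (\<Union>(i, j)\<in>?I. verts (C i) \<times> verts (C j))"
  define g where "g = (\<lambda>(x, y). {tree_path x y, rev (tree_path x y)})"
  have B_E: "\<exists>i j. i \<in> {1..m} \<and> j \<in> {1..m} \<and> i < j \<and> x \<in> verts (C i) \<and> y \<in> verts (C j)"
    if xy: "(x, y) \<in> B" for x y
  proof -
    obtain i j where ij: "1 \<le> i" "i < j" "j \<le> m" "x \<in> verts (C i)" "y \<in> verts (C j)"
      using xy unfolding B_def by auto
    then have "i \<in> {1..m}" "j \<in> {1..m}" by auto
    with ij show ?thesis by blast
  qed
  have B_verts: "x \<in> verts T - {v} \<and> y \<in> verts T - {v}" if "(x, y) \<in> B" for x y
    using B_E[OF that] sub by blast
  have B_asym: "(y, x) \<notin> B" if "(x, y) \<in> B" for x y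
    using B_E[OF that] B_E[of y x] same by (metis less_asym)
  have "inj_on g B"
  proof (rule inj_onI)
    fix a b assume ab: "a \<in> B" "b \<in> B" "g a = g b"
    obtain x y x' y' where xy: "a = (x, y)" "b = (x', y')" by fastforce
    have "x = x' \<and> y = y' \<or> x = y' \<and> y = x'"
      using tree_path_class_eqD[OF assms(1), of x y x' y'] B_verts ab unfolding xy g_def by auto
    then show "a = b" using B_asym ab unfolding xy by auto
  qed
  moreover have "g ` B = geodesics_through T v"
  proof (intro equalityI subsetI)
    fix S assume "S \<in> g ` B"
    then obtain x y where S: "S = {tree_path x y, rev (tree_path x y)}" and xy: "(x, y) \<in> B"
      by (auto simp: g_def)
    obtain i j where "i \<in> {1..m}" "j \<in> {1..m}" "i < j" "x \<in> verts (C i)" "y \<in> verts (C j)"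
      using B_E[OF xy] by blast
    then have "\<not> x \<rightarrow>\<^sup>*\<^bsub>del_vert v\<^esub> y"
      using reach[of i x] same[of i j y] by auto
    then show "S \<in> geodesics_through T v"
      unfolding geodesics_through_tree[OF assms(1)]
      using B_verts[OF xy] S
      by (auto intro!: exI[of _ "tree_path x y"]
        simp: vpath_tree_path hd_tree_path last_tree_path assms(1))
  next
    fix S assume "S \<in> geodesics_through T v"
    then obtain p where S: "S = {p, rev p}" and p: "vpath p T" "hd p \<noteq> v" "last p \<noteq> v"
      "\<not> hd p \<rightarrow>\<^sup>*\<^bsub>del_vert v\<^esub> last p"
      unfolding geodesics_through_tree[OF assms(1)] by blast
    have ends: "hd p \<in> verts T - {v}" "last p \<in> verts T - {v}"
      using p by (auto simp: vpath_def vwalk_def)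
    have g_p: "g (hd p, last p) = S" "g (last p, hd p) = S"
    proof -
      have eq: "tree_path (hd p) (last p) = p" using assms(1) p(1) by (rule tree_path_eq)
      then have "tree_path (last p) (hd p) = rev p"
        using rev_tree_path[OF assms(1), of "hd p" "last p"] ends by simp
      with eq show "g (hd p, last p) = S" "g (last p, hd p) = S"
        using S unfolding g_def by auto
    qed
    obtain i j where ij: "i \<in> {1..m}" "hd p \<in> verts (C i)" "j \<in> {1..m}" "last p \<in> verts (C j)"
      using cover ends by blast
    then have "i \<noteq> j" using reach[of i "hd p"] p(4) by auto
    then have "(hd p, last p) \<in> B \<or> (last p, hd p) \<in> B"
      using ij unfolding B_def by (cases "i < j") auto
    then show "S \<in> g ` B" using g_p by blast
  qed
  ultimately have "stress T v = card B"
    unfolding stress_def by (metis card_image)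
  also have "\<dots> = (\<Sum>(i, j)\<in>?I. card (verts (C i)) * card (verts (C j)))"
    unfolding B_def
  proof (rule card_UN_pairs_disjoint)
    show "finite (verts (C i))" if "i \<in> {1..m}" for i
      using sub[OF that] finite_subset[of _ "verts T"] by auto
    show "disjoint_family_on (\<lambda>i. verts (C i)) {1..m}"
      using same unfolding disjoint_family_on_def by blast
  qed
  finally show ?thesis .
qed

end
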